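(* Let $n\ge 1$ be an integer, $p\in[0,1]$, and $G\sim\vec{G}(n,p)$. Let $\vec\beta_1(G)$ be the first Betti number of the non-regular path homology of $G$. Then $$\mathbb{P}(\vec\beta_1(G)>0)\le \binom{n}{4}4!\sum_{m=0}^{3}p^3(1-p)^{c_m}\left(1-\sum_{l=0}^{8}q_{m,l}\,p^l(1-p)^{8-l}\right)^{n-4}+\binom{n}{2}p^2\left[1-p^2\right]^{2n-4}+2\binom{n}{3}p^3\left[1-p^3\right]^{2n-6},$$ where $(c_0,c_1,c_2,c_3)=(2,4,4,4)$ and $$Q=(q_{m,l})_{0\le m\le 3,\,0\le l\le 8}=\begin{pmatrix}0&0&0&2&11&22&23&8&1\\0&0&0&4&19&33&25&8&1\\0&0&0&4&19&33&25&8&1\\0&0&0&2&16&34&26&8&1\end{pmatrix}.$$ (Terms whose binomial coefficient is $0$ are read as $0$.)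
   Context: A simple digraph is $G=(V,E)$ with $E\subseteq\{(i,j)\in V\times V: i\neq j\}$ (both $(i,j)$ and $(j,i)$ may be present). $\vec{G}(n,p)$ is the random simple digraph on vertex set $\{1,\dots,n\}$ in which each of the $n(n-1)$ possible directed edges is present independently with probability $p$. Path homology (coefficients in $\mathbb{Z}$). For $m\ge 0$ let $\Lambda_m$ be the free $\mathbb{Z}$-module with basis $e_{v_0\dots v_m}$ over all sequences of $m+1$ vertices, and let $\mathcal{A}_m\subseteq\Lambda_m$ be the submodule spanned by the allowed sequences, i.e. those with $(v_i,v_{i+1})\in E$ for all $i$. Put $\Lambda_{-1}=\mathcal{A}_{-1}=\mathbb{Z}$. For $m\geq 1$ let $\partial_m:\Lambda_m\to\Lambda_{m-1}$, $\partial_m(e_{v_0\dots v_m})=\sum_{i=0}^m(-1)^i e_{v_0\dots\hat{v_i}\dots v_m}$, and let $\partial_0:\Lambda_0\to\mathbb{Z}$ be the sum of coefficients. Let $\Omega_m=\{v\in\mathcal{A}_m:\partial_m v\in\mathcal{A}_{m-1}\}$ for $m\ge0$ and $\Omega_{-1}=\mathbb{Z}$. The non-regular chain complex is $\cdots\to\Omega_2\to\Omega_1\to\Omega_0\to\mathbb{Z}\to0$ with the restrictions of $\partial_m$; its homology is non-regular path homology and $\vec\beta_k(G)=\operatorname{rank}(\ker\partial_k/\operatorname{im}\partial_{k+1})$. *)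

theory Defs
  imports
    "HOL-Algebra.Free_Abelian_Groups"
    "HOL-Library.Extended_Nat"
    "HOL-Probability.Product_PMF"
    "Graph_Theory.Pair_Digraph"
begin

text \<open>
  A digraph is a record of a vertex set and a set of arcs \<open>(i, j)\<close>. It is simple if it
  satisfies the locale \<^locale>\<open>pair_loopfree_digraph\<close>; all digraphs in the support of the random
  model below do.
\<close>

definition random_digraph :: "nat \<Rightarrow> real \<Rightarrow> nat pair_pre_digraph pmf" where
  "random_digraph n p =
     map_pmf (\<lambda>present. \<lparr>pverts = {1..n}, parcs = {e. present e}\<rparr>)
       (Pi_pmf {(i, j). i \<in> {1..n} \<and> j \<in> {1..n} \<and> i \<noteq> j} False (\<lambda>_. bernoulli_pmf p))"

lemma random_digraph_simple:
  assumes "G \<in> set_pmf (random_digraph n p)"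
  shows "pverts G = {1..n}" "pair_digraph G"
proof -
  let ?A = "{(i, j). i \<in> {1..n} \<and> j \<in> {1..n} \<and> i \<noteq> j}"
  have fin: "finite ?A"
    by (rule finite_subset[of _ "{1..n} \<times> {1..n}"]) auto
  obtain f where f: "f \<in> set_pmf (Pi_pmf ?A False (\<lambda>_. bernoulli_pmf p))"
    and G: "G = \<lparr>pverts = {1..n}, parcs = {e. f e}\<rparr>"
    using assms unfolding random_digraph_def by auto
  have sub: "{e. f e} \<subseteq> ?A"
    using set_Pi_pmf_subset[OF fin, of False "\<lambda>_. bernoulli_pmf p"] f by blast
  show "pverts G = {1..n}" by (simp add: G)
  show "pair_digraph G"
    by unfold_locales (use sub finite_subset[OF sub fin] in \<open>auto simp: G\<close>)
qed


section \<open>Non-regular path homology over the integers\<close>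

text \<open>
  Degrees are integers \<open>m \<ge> -1\<close>, and \<open>e\<close> indexed by \<open>v\<^sub>0 \<dots> v\<^sub>m\<close> is \<open>frag_of [v\<^sub>0, \<dots>, v\<^sub>m]\<close>.
\<close>

definition vertex_seqs :: "'a pair_pre_digraph \<Rightarrow> int \<Rightarrow> 'a list set" where
  "vertex_seqs G m = {vs. int (length vs) = m + 1 \<and> set vs \<subseteq> pverts G}"

definition allowed_seqs :: "'a pair_pre_digraph \<Rightarrow> int \<Rightarrow> 'a list set" where
  "allowed_seqs G m = {vs \<in> vertex_seqs G m. successively (\<lambda>u v. (u, v) \<in> parcs G) vs}"

text \<open>
  In degree \<open>- 1\<close> the only sequence is \<open>[]\<close>, which is allowed, so \<open>\<Lambda>\<close> and \<open>\<A>\<close> are there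
  both the infinite cyclic group generated by \<^term>\<open>frag_of []\<close>.
\<close>

definition path_chain_group :: "'a pair_pre_digraph \<Rightarrow> int \<Rightarrow> ('a list \<Rightarrow>\<^sub>0 int) monoid" where
  "path_chain_group G m = free_Abelian_group (vertex_seqs G m)"

definition allowed_chains :: "'a pair_pre_digraph \<Rightarrow> int \<Rightarrow> ('a list \<Rightarrow>\<^sub>0 int) set" where
  "allowed_chains G m = {c. Poly_Mapping.keys c \<subseteq> allowed_seqs G m}"

text \<open>
  One formula serves all degrees: in degree \<open>0\<close> it is the sum of coefficients (times
  \<^term>\<open>frag_of []\<close>), and in degree \<open>- 1\<close> it is the zero map.
\<close>

definition path_boundary :: "('a list \<Rightarrow>\<^sub>0 int) \<Rightarrow> ('a list \<Rightarrow>\<^sub>0 int)" where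
  "path_boundary =
     frag_extend (\<lambda>vs. \<Sum>i<length vs. frag_cmul ((-1) ^ i) (frag_of (take i vs @ drop (Suc i) vs)))"

lemma path_boundary_of:
  "path_boundary (frag_of vs) =
     (\<Sum>i<length vs. frag_cmul ((-1) ^ i) (frag_of (take i vs @ drop (Suc i) vs)))"
  by (simp add: path_boundary_def)

lemma path_boundary_0 [simp]: "path_boundary 0 = 0"
  by (simp add: path_boundary_def)

lemma path_boundary_diff: "path_boundary (a - b) = path_boundary a - path_boundary b"
  by (simp add: path_boundary_def frag_extend_diff)

lemma path_boundary_add: "path_boundary (a + b) = path_boundary a + path_boundary b"
  by (simp add: path_boundary_def frag_extend_add)

lemma path_boundary_Cons_of:
  "path_boundary (frag_of (v # vs)) =
     frag_of vs - frag_extend (\<lambda>ws. frag_of (v # ws)) (path_boundary (frag_of vs))"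
  by (simp add: path_boundary_of lessThan_Suc_eq_insert_0 sum.reindex frag_extend_sum
      frag_extend_cmul sum_negf flip: minus_frag_cmul)

lemma path_boundary_Cons:
  "path_boundary (frag_extend (\<lambda>ws. frag_of (v # ws)) c) =
     c - frag_extend (\<lambda>ws. frag_of (v # ws)) (path_boundary c)"
proof -
  have "Poly_Mapping.keys c \<subseteq> UNIV" by simp
  then show ?thesis
    by (induction c rule: frag_induction)
       (auto simp: path_boundary_Cons_of frag_extend_diff path_boundary_diff)
qed

lemma path_boundary_boundary: "path_boundary (path_boundary c) = 0"
proof -
  have of: "path_boundary (path_boundary (frag_of vs)) = 0" for vs :: "'a list"
  proof (induction vs)
    case Nil
    show ?case by (simp add: path_boundary_of)
  next
    case (Cons v vs)
    then show ?case
      by (simp add: path_boundary_Cons_of path_boundary_Cons path_boundary_diff)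
  qed
  have "Poly_Mapping.keys c \<subseteq> UNIV" by simp
  then show ?thesis
    by (induction c rule: frag_induction) (auto simp: of path_boundary_diff)
qed

lemma path_boundary_degree_0:
  assumes "c \<in> carrier (path_chain_group G 0)"
  shows "path_boundary c =
    frag_cmul (\<Sum>vs\<in>Poly_Mapping.keys c. Poly_Mapping.lookup c vs) (frag_of [])"
proof -
  have "length vs = 1" if "vs \<in> Poly_Mapping.keys c" for vs
    using assms that by (auto simp: path_chain_group_def vertex_seqs_def)
  then have "path_boundary c =
      (\<Sum>vs\<in>Poly_Mapping.keys c. frag_cmul (Poly_Mapping.lookup c vs) (frag_of []))"
    unfolding path_boundary_def frag_extend_def by (intro sum.cong) auto
  also have "\<dots> = frag_cmul (\<Sum>vs\<in>Poly_Mapping.keys c. Poly_Mapping.lookup c vs) (frag_of [])"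
    by (rule poly_mapping_eqI) (simp add: lookup_sum sum_distrib_right)
  finally show ?thesis .
qed

definition invariant_chains :: "'a pair_pre_digraph \<Rightarrow> int \<Rightarrow> ('a list \<Rightarrow>\<^sub>0 int) set" where
  "invariant_chains G m =
     {c \<in> allowed_chains G m. path_boundary c \<in> allowed_chains G (m - 1)}"

definition path_cycles :: "'a pair_pre_digraph \<Rightarrow> int \<Rightarrow> ('a list \<Rightarrow>\<^sub>0 int) set" where
  "path_cycles G m = {c \<in> invariant_chains G m. path_boundary c = 0}"

definition path_boundaries :: "'a pair_pre_digraph \<Rightarrow> int \<Rightarrow> ('a list \<Rightarrow>\<^sub>0 int) set" where
  "path_boundaries G m = path_boundary ` invariant_chains G (m + 1)"

lemma allowed_chains_diff:
  "\<lbrakk>a \<in> allowed_chains G m; b \<in> allowed_chains G m\<rbrakk> \<Longrightarrow> a - b \<in> allowed_chains G m"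
  unfolding allowed_chains_def using keys_diff by fastforce

lemma invariant_chains_diff:
  "\<lbrakk>a \<in> invariant_chains G m; b \<in> invariant_chains G m\<rbrakk> \<Longrightarrow> a - b \<in> invariant_chains G m"
  by (simp add: invariant_chains_def allowed_chains_diff path_boundary_diff)

lemma zero_invariant_chains [simp]: "0 \<in> invariant_chains G m"
  by (simp add: invariant_chains_def allowed_chains_def)

lemma path_boundaries_subset_cycles: "path_boundaries G m \<subseteq> path_cycles G m"
  by (auto simp: path_boundaries_def path_cycles_def invariant_chains_def
      path_boundary_boundary allowed_chains_def)

lemma subgroup_free_Abelian_groupI:
  assumes "H \<subseteq> carrier (free_Abelian_group S)" "0 \<in> H" "\<And>a b. \<lbrakk>a \<in> H; b \<in> H\<rbrakk> \<Longrightarrow> a - b \<in> H"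
  shows "subgroup H (free_Abelian_group S)"
proof
  show "inv\<^bsub>free_Abelian_group S\<^esub> x \<in> H" if "x \<in> H" for x
    using assms(1) assms(3)[OF assms(2) that] that by auto
  show "x \<otimes>\<^bsub>free_Abelian_group S\<^esub> y \<in> H" if "x \<in> H" "y \<in> H" for x y
    using assms(3)[OF that(1) assms(3)[OF assms(2) that(2)]] by simp
qed (use assms in auto)

lemma subgroup_path_cycles: "subgroup (path_cycles G m) (path_chain_group G m)"
  unfolding path_chain_group_def
proof (rule subgroup_free_Abelian_groupI)
  show "path_cycles G m \<subseteq> carrier (free_Abelian_group (vertex_seqs G m))"
    by (auto simp: path_cycles_def invariant_chains_def allowed_chains_def allowed_seqs_def)
qed (auto simp: path_cycles_def invariant_chains_diff path_boundary_diff)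

lemma subgroup_path_boundaries: "subgroup (path_boundaries G m) (path_chain_group G m)"
  unfolding path_chain_group_def
proof (rule subgroup_free_Abelian_groupI)
  show "path_boundaries G m \<subseteq> carrier (free_Abelian_group (vertex_seqs G m))"
    using path_boundaries_subset_cycles[of G m] subgroup.subset[OF subgroup_path_cycles[of G m]]
    by (auto simp: path_chain_group_def)
  show "0 \<in> path_boundaries G m"
    unfolding path_boundaries_def by (rule image_eqI[of _ _ 0]) auto
  show "a - b \<in> path_boundaries G m" if "a \<in> path_boundaries G m" "b \<in> path_boundaries G m" for a b
    using that unfolding path_boundaries_def
    by (auto simp: path_boundary_diff[symmetric] intro!: imageI invariant_chains_diff)
qed

definition path_homology_group ::
    "'a pair_pre_digraph \<Rightarrow> int \<Rightarrow> ('a list \<Rightarrow>\<^sub>0 int) set monoid" where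
  "path_homology_group G m =
     (path_chain_group G m)\<lparr>carrier := path_cycles G m\<rparr> Mod path_boundaries G m"

lemma comm_group_path_homology_group: "comm_group (path_homology_group G m)"
proof -
  let ?Z = "(path_chain_group G m)\<lparr>carrier := path_cycles G m\<rparr>"
  have C: "comm_group (path_chain_group G m)"
    by (simp add: path_chain_group_def abelian_free_Abelian_group)
  have Z: "comm_group ?Z"
  proof (rule group.group_comm_groupI)
    show "group ?Z"
      by (rule subgroup.subgroup_is_group[OF subgroup_path_cycles comm_group.axioms(2)[OF C]])
  qed (simp add: path_chain_group_def add.commute)
  have "subgroup (path_boundaries G m) ?Z"
    using C by (intro group.subgroup_incl[OF comm_group.axioms(2)] subgroup_path_boundaries
        subgroup_path_cycles path_boundaries_subset_cycles)
  with Z show ?thesis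
    unfolding path_homology_group_def by (rule comm_group.abelian_FactGroup)
qed

text \<open>
  The rank of an abelian group (written multiplicatively) is the supremum of the sizes of its
  finite subsets that are linearly independent over the integers.
\<close>

definition int_independent :: "('a, 'b) monoid_scheme \<Rightarrow> 'a set \<Rightarrow> bool" where
  "int_independent A S \<longleftrightarrow>
     S \<subseteq> carrier A \<and> finite S \<and>
     (\<forall>a :: 'a \<Rightarrow> int. finprod A (\<lambda>x. x [^]\<^bsub>A\<^esub> a x) S = \<one>\<^bsub>A\<^esub> \<longrightarrow> (\<forall>x\<in>S. a x = 0))"

definition abelian_rank :: "('a, 'b) monoid_scheme \<Rightarrow> enat" where
  "abelian_rank A = (SUP S \<in> {S. int_independent A S}. enat (card S))"

definition path_betti :: "'a pair_pre_digraph \<Rightarrow> int \<Rightarrow> enat" where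
  "path_betti G k = abelian_rank (path_homology_group G k)"


section \<open>Constants of the bound\<close>

definition c_exponents :: "nat list" where
  "c_exponents = [2, 4, 4, 4]"

definition Q_matrix :: "real list list" where
  "Q_matrix =
     [[0, 0, 0, 2, 11, 22, 23, 8, 1],
      [0, 0, 0, 4, 19, 33, 25, 8, 1],
      [0, 0, 0, 4, 19, 33, 25, 8, 1],
      [0, 0, 0, 2, 16, 34, 26, 8, 1]]"

end

theory Submission
  imports Defs
begin

text \<open>
  Suppose that every double edge and every cyclic triangle is filled by a cone over it. Then all
  closed walks of length at most 3 are boundaries. A longer closed walk can be shortened without
  changing its homology class if some three consecutive steps have a repeated vertex or a chord;
  otherwise a vertex \<open>x\<close> adjacent to both ends of a 3-step subpath \<open>s, t, u, v\<close> gives the shorter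
  walk through \<open>s, x, v\<close>, and the difference is a boundary as soon as \<open>x\<close> triangulates the
  resulting pentagon, possibly with the help of one square. As closed walks generate the
  1-cycles, a positive first Betti number forces an unfilled double edge, an unfilled cyclic
  triangle, or a chordless 3-step path without such an \<open>x\<close>. The bound is the union bound over
  these obstructions. Reversing a path if necessary, its middle arc points forwards, so that four
  orientations remain; the same estimate serves all four and is stronger than each of the four
  summands.
\<close>

section \<open>Local obstructions\<close>

definition adjacent :: "'a rel \<Rightarrow> 'a \<Rightarrow> 'a \<Rightarrow> bool" where
  "adjacent E u v \<longleftrightarrow> (u, v) \<in> E \<or> (v, u) \<in> E"

definition oriented :: "bool \<Rightarrow> 'a \<Rightarrow> 'a \<Rightarrow> 'a \<times> 'a" where
  "oriented d u v = (if d then (u, v) else (v, u))"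

text \<open>Only apexes whose arcs to \<open>K\<close> all point in or all point out are considered:
  every arc inside \<open>K\<close> then spans a transitive triangle with the apex.\<close>

definition cone_free :: "'a set \<Rightarrow> 'a rel \<Rightarrow> 'a set \<Rightarrow> bool" where
  "cone_free V E K \<longleftrightarrow> (\<forall>x\<in>V - K. \<not> K \<times> {x} \<subseteq> E \<and> \<not> {x} \<times> K \<subseteq> E)"

definition unfilled_edge :: "'a set \<Rightarrow> 'a rel \<Rightarrow> 'a \<Rightarrow> 'a \<Rightarrow> bool" where
  "unfilled_edge V E u v \<longleftrightarrow> {(u, v), (v, u)} \<subseteq> E \<and> cone_free V E {u, v}"

definition unfilled_triangle :: "'a set \<Rightarrow> 'a rel \<Rightarrow> 'a \<Rightarrow> 'a \<Rightarrow> 'a \<Rightarrow> bool" where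
  "unfilled_triangle V E u v w \<longleftrightarrow>
     {(u, v), (v, w), (w, u)} \<subseteq> E \<and> cone_free V E {u, v, w}"

text \<open>
  In a path \<open>s, t, u, v\<close> with middle arc \<open>(t, u)\<close> the flags \<open>d\<close> and \<open>e\<close> tell whether the outer
  edges point forwards. The last two disjuncts say that the 4-cycle \<open>x, t, u, v\<close>, respectively
  \<open>s, t, u, x\<close>, is oriented as a square \<open>a \<rightarrow> b \<rightarrow> c\<close>, \<open>a \<rightarrow> b' \<rightarrow> c\<close>; given the two arcs of the
  path that it contains, exactly one orientation of its other two edges achieves this.
\<close>

definition shortcut :: "'a rel \<Rightarrow> bool \<Rightarrow> bool \<Rightarrow> 'a \<Rightarrow> 'a \<Rightarrow> 'a \<Rightarrow> 'a \<Rightarrow> 'a \<Rightarrow> bool" where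
  "shortcut E d e s t u v x \<longleftrightarrow> adjacent E s x \<and> adjacent E v x \<and>
     (adjacent E t x \<and> adjacent E u x \<or>
      {oriented e t x, (x, v)} \<subseteq> E \<or>
      {(s, x), oriented d x u} \<subseteq> E)"

text \<open>Exactly seven arcs inside the path are prescribed, three present and four absent, whence
  the factor \<open>p ^ 3 * (1 - p) ^ 4\<close> below. The pair \<open>s\<close>, \<open>v\<close>
  and the reverses of the path arcs stay free.\<close>

definition irreducible_path :: "'a set \<Rightarrow> 'a rel \<Rightarrow> bool \<Rightarrow> bool \<Rightarrow> 'a \<Rightarrow> 'a \<Rightarrow> 'a \<Rightarrow> 'a \<Rightarrow> bool" where
  "irreducible_path V E d e s t u v \<longleftrightarrow> {oriented d s t, (t, u), oriented e u v} \<subseteq> E \<and>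
     {(s, u), (u, s), (t, v), (v, t)} \<inter> E = {} \<and>
     (\<forall>x\<in>V - {s, t, u, v}. \<not> shortcut E d e s t u v x)"

section \<open>Boundaries and closed walks\<close>

lemma adjacent_sym: "adjacent E u v \<longleftrightarrow> adjacent E v u"
  by (auto simp: adjacent_def)

lemma path_boundaries_diff:
  "\<lbrakk>a \<in> path_boundaries G m; b \<in> path_boundaries G m\<rbrakk> \<Longrightarrow> a - b \<in> path_boundaries G m"
  unfolding path_boundaries_def
  by (auto simp: path_boundary_diff[symmetric] intro!: imageI invariant_chains_diff)

lemma path_boundaries_0 [simp]: "0 \<in> path_boundaries G m"
  unfolding path_boundaries_def by (rule image_eqI[of _ _ 0]) auto

lemma path_boundaries_minus: "a \<in> path_boundaries G m \<Longrightarrow> - a \<in> path_boundaries G m"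
  using path_boundaries_diff[OF path_boundaries_0, of a G m] by simp

lemma path_boundaries_add:
  "\<lbrakk>a \<in> path_boundaries G m; b \<in> path_boundaries G m\<rbrakk> \<Longrightarrow> a + b \<in> path_boundaries G m"
  using path_boundaries_diff[OF _ path_boundaries_minus, of a G m b] by simp

lemma path_boundary_edge: "path_boundary (frag_of [u, v]) = frag_of [v] - frag_of [u]"
  by (simp add: path_boundary_Cons_of path_boundary_of[of "[]"] frag_extend_diff)

lemma path_boundary_triple:
  "path_boundary (frag_of [u, v, w]) = frag_of [u, v] + frag_of [v, w] - frag_of [u, w]"
  by (simp add: path_boundary_Cons_of path_boundary_of[of "[]"] frag_extend_diff)

lemma allowed_seqs_1: "allowed_seqs G 1 = {[u, v] | u v. (u, v) \<in> parcs G \<and> u \<in> pverts G \<and> v \<in> pverts G}"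
proof -
  have "int (length vs) = 2 \<longleftrightarrow> (\<exists>u v. vs = [u, v])" for vs :: "'a list"
    by (auto simp: length_Suc_conv numeral_2_eq_2 nat_eq_iff2 dest: arg_cong[of "int _" _ nat])
  then show ?thesis
    by (auto simp: allowed_seqs_def vertex_seqs_def)
qed

section \<open>Squares and transitive triangles as boundaries\<close>

context pair_wf_digraph
begin

text \<open>The generators \<open>[u, v, w]\<close> and \<open>[u, x, w]\<close> share the middle
  face \<open>[u, w]\<close>. It may fail to be an arc, but it cancels in their difference, which is
  therefore invariant.\<close>

lemma square_in_path_boundaries:
  assumes "(u, v) \<in> parcs G" "(v, w) \<in> parcs G" "(u, x) \<in> parcs G" "(x, w) \<in> parcs G"
  shows "frag_of [u, v] + frag_of [v, w] - (frag_of [u, x] + frag_of [x, w]) \<in> path_boundaries G 1"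
proof -
  let ?c = "frag_of [u, v, w] - frag_of [u, x, w]"
  have 1: "path_boundary ?c = frag_of [u, v] + frag_of [v, w] - (frag_of [u, x] + frag_of [x, w])"
    by (simp add: path_boundary_diff path_boundary_triple)
  have "?c \<in> allowed_chains G 2"
    using assms by (auto simp: allowed_chains_def allowed_seqs_def vertex_seqs_def
        dest!: subsetD[OF keys_diff] dest: in_arcsD1 in_arcsD2)
  moreover have "path_boundary ?c \<in> allowed_chains G 1"
    unfolding 1 using assms in_arcsD1 in_arcsD2
    by (auto simp: allowed_chains_def allowed_seqs_1 dest!: subsetD[OF keys_diff] subsetD[OF keys_add])
  ultimately show ?thesis
    unfolding path_boundaries_def invariant_chains_def 1[symmetric] by (intro imageI) simp
qed

text \<open>All faces of \<open>[u, v, w]\<close> are arcs, so this generator is invariant by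
  itself.\<close>

lemma triangle_in_path_boundaries:
  assumes "(u, v) \<in> parcs G" "(v, w) \<in> parcs G" "(u, w) \<in> parcs G"
  shows "frag_of [u, v] + frag_of [v, w] - frag_of [u, w] \<in> path_boundaries G 1"
proof -
  let ?c = "frag_of [u, v, w]"
  have "?c \<in> allowed_chains G 2"
    unfolding allowed_chains_def using assms
    by (auto simp: allowed_seqs_def vertex_seqs_def dest: in_arcsD1 in_arcsD2)
  moreover have "path_boundary ?c \<in> allowed_chains G 1"
    unfolding path_boundary_triple using assms in_arcsD1 in_arcsD2
    by (auto simp: allowed_chains_def allowed_seqs_1 dest!: subsetD[OF keys_diff] subsetD[OF keys_add])
  ultimately show ?thesis
    unfolding path_boundaries_def invariant_chains_def path_boundary_triple[symmetric]
    by (intro imageI) simp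
qed

end

text \<open>
  For a double edge the arc leaving the smaller vertex is chosen, which makes this exactly
  antisymmetric.
\<close>

definition edge_chain :: "'a::linorder rel \<Rightarrow> 'a \<Rightarrow> 'a \<Rightarrow> 'a list \<Rightarrow>\<^sub>0 int" where
  "edge_chain E u v =
     (if (u, v) \<in> E \<and> (u < v \<or> (v, u) \<notin> E) then frag_of [u, v] else - frag_of [v, u])"

lemma edge_chain_swap:
  assumes "adjacent E u v" "u \<noteq> v"
  shows "edge_chain E v u = - edge_chain E u v"
  using assms by (auto simp: edge_chain_def adjacent_def)

text \<open>Meant for walks in the underlying undirected graph, given by their vertices; a step
  against the chosen arc counts negatively.\<close>

fun walk_chain :: "'a::linorder rel \<Rightarrow> 'a list \<Rightarrow> 'a list \<Rightarrow>\<^sub>0 int" where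
  "walk_chain E (u # v # vs) = edge_chain E u v + walk_chain E (v # vs)"
| "walk_chain E _ = 0"

lemma walk_chain_append:
  "walk_chain E (us @ v # vs) = walk_chain E (us @ [v]) + walk_chain E (v # vs)"
  by (induction us rule: walk_chain.induct[of _ E]) (auto simp: ac_simps)

text \<open>The deterministic half of the argument: digraphs with none of the three obstructions.
  The linear order serves the choice of arcs in \<open>edge_chain\<close>.\<close>

locale filled_digraph = pair_loopfree_digraph G for G :: "'a :: linorder pair_pre_digraph" +
  assumes filled_edge: "\<not> unfilled_edge (pverts G) (parcs G) u v"
  assumes filled_triangle: "\<not> unfilled_triangle (pverts G) (parcs G) u v w"
  assumes reducible_path:
    "distinct [s, t, u, v] \<Longrightarrow> \<not> irreducible_path (pverts G) (parcs G) d e s t u v"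
begin

abbreviation adj :: "'a \<Rightarrow> 'a \<Rightarrow> bool" where
  "adj \<equiv> adjacent (parcs G)"

abbreviation edge :: "'a \<Rightarrow> 'a \<Rightarrow> 'a list \<Rightarrow>\<^sub>0 int" where
  "edge \<equiv> edge_chain (parcs G)"

abbreviation null :: "('a list \<Rightarrow>\<^sub>0 int) \<Rightarrow> bool" where
  "null c \<equiv> c \<in> path_boundaries G 1"

section \<open>Double edges, triangles and squares modulo boundaries\<close>

lemma adj_irrefl: "\<not> adj u u"
  by (auto simp: adjacent_def dest: pair_no_loops)

lemma edge_swap: "adj u v \<Longrightarrow> edge v u = - edge u v"
  by (rule edge_chain_swap) (auto simp: adj_irrefl)

text \<open>In the non-regular complex the boundary of \<open>[u, v, u]\<close> contains the loop
  \<open>[u, u]\<close>, which is not allowed, so a double edge does not bound by itself. With an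
  apex \<open>x\<close> it is the sum of two transitive triangles, in which the arcs at
  \<open>x\<close> cancel.\<close>

lemma double_edge_null:
  assumes "(u, v) \<in> parcs G" "(v, u) \<in> parcs G"
  shows "null (frag_of [u, v] + frag_of [v, u])"
proof -
  from filled_edge[of u v] assms obtain x where
    "{u, v} \<times> {x} \<subseteq> parcs G \<or> {x} \<times> {u, v} \<subseteq> parcs G"
    unfolding unfilled_edge_def cone_free_def by blast
  then show ?thesis
  proof
    assume "{u, v} \<times> {x} \<subseteq> parcs G"
    then have "null ((frag_of [u, v] + frag_of [v, x] - frag_of [u, x]) +
        (frag_of [v, u] + frag_of [u, x] - frag_of [v, x]))"
      using assms by (intro path_boundaries_add triangle_in_path_boundaries) auto
    then show ?thesis by (simp add: algebra_simps)
  next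
    assume "{x} \<times> {u, v} \<subseteq> parcs G"
    then have "null ((frag_of [x, u] + frag_of [u, v] - frag_of [x, v]) +
        (frag_of [x, v] + frag_of [v, u] - frag_of [x, u]))"
      using assms by (intro path_boundaries_add triangle_in_path_boundaries) auto
    then show ?thesis by (simp add: algebra_simps)
  qed
qed

text \<open>The difference is nonzero only for the arc of a double edge that was not chosen, and
  then it is the whole double edge.\<close>

lemma frag_of_edge_null:
  assumes "(u, v) \<in> parcs G"
  shows "null (frag_of [u, v] - edge u v)"
  using assms double_edge_null[of u v] by (auto simp: edge_chain_def)

lemma square_null:
  assumes "(u, v) \<in> parcs G" "(v, w) \<in> parcs G" "(u, x) \<in> parcs G" "(x, w) \<in> parcs G"
  shows "null (edge u v + edge v w - (edge u x + edge x w))"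
proof -
  have "null ((frag_of [u, v] + frag_of [v, w] - (frag_of [u, x] + frag_of [x, w]))
     - (frag_of [u, v] - edge u v) - (frag_of [v, w] - edge v w)
     + (frag_of [u, x] - edge u x) + (frag_of [x, w] - edge x w))"
    using assms
    by (intro path_boundaries_add path_boundaries_diff square_in_path_boundaries frag_of_edge_null)
  then show ?thesis by (simp add: algebra_simps)
qed

lemma transitive_triangle_null:
  assumes "(u, v) \<in> parcs G" "(v, w) \<in> parcs G" "(u, w) \<in> parcs G"
  shows "null (edge u v + edge v w - edge u w)"
proof -
  have "null ((frag_of [u, v] + frag_of [v, w] - frag_of [u, w])
     - (frag_of [u, v] - edge u v) - (frag_of [v, w] - edge v w) + (frag_of [u, w] - edge u w))"
    using assms
    by (intro path_boundaries_add path_boundaries_diff triangle_in_path_boundaries frag_of_edge_null)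
  then show ?thesis by (simp add: algebra_simps)
qed

text \<open>The three transitive triangles between the apex and the sides add up to the cyclic
  triangle, since each arc at the apex occurs twice with opposite signs.\<close>

lemma cyclic_triangle_null:
  assumes "(u, v) \<in> parcs G" "(v, w) \<in> parcs G" "(w, u) \<in> parcs G"
  shows "null (edge u v + edge v w + edge w u)"
proof -
  from filled_triangle[of u v w] assms obtain x where
    "{u, v, w} \<times> {x} \<subseteq> parcs G \<or> {x} \<times> {u, v, w} \<subseteq> parcs G"
    unfolding unfilled_triangle_def cone_free_def by blast
  then show ?thesis
  proof
    assume "{u, v, w} \<times> {x} \<subseteq> parcs G"
    then have "null ((edge u v + edge v x - edge u x) + (edge v w + edge w x - edge v x) +
        (edge w u + edge u x - edge w x))"
      using assms by (intro path_boundaries_add transitive_triangle_null) auto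
    then show ?thesis by (simp add: algebra_simps)
  next
    assume "{x} \<times> {u, v, w} \<subseteq> parcs G"
    then have "null ((edge x u + edge u v - edge x v) + (edge x v + edge v w - edge x w) +
        (edge x w + edge w u - edge x u))"
      using assms by (intro path_boundaries_add transitive_triangle_null) auto
    then show ?thesis by (simp add: algebra_simps)
  qed
qed

text \<open>Three mutually adjacent vertices carry a transitive triangle, in one of six orders, or a
  cyclic one, in one of two senses. By antisymmetry of \<open>edge\<close> each of these yields the
  claim up to sign.\<close>

lemma triangle_null:
  assumes "adj u v" "adj v w" "adj u w"
  shows "null (edge u v + edge v w - edge u w)"
proof -
  note swap = edge_swap[OF assms(1)] edge_swap[OF assms(2)] edge_swap[OF assms(3)]
  have A: "null c \<longleftrightarrow> null (- c)" for c
    using path_boundaries_minus[of c G 1] path_boundaries_minus[of "-c" G 1] by auto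
  show ?thesis
    using assms transitive_triangle_null[of u v w] transitive_triangle_null[of u w v]
      transitive_triangle_null[of v u w] transitive_triangle_null[of v w u]
      transitive_triangle_null[of w u v] transitive_triangle_null[of w v u]
      cyclic_triangle_null[of u v w] cyclic_triangle_null[of u w v]
      A[of "edge u v + edge v w - edge u w"]
    by (auto simp: adjacent_def swap algebra_simps)
qed

lemma shortcut_walk:
  assumes adj: "adj s t" "(t, u) \<in> parcs G" "adj u v"
    and chordless: "\<not> adj s u" "\<not> adj t v"
    and dist: "distinct [s, t, u, v]"
  obtains x where "adj s x" "adj x v" "null (edge s t + edge t u + edge u v - (edge s x + edge x v))"
proof -
  \<comment> \<open>A double outer edge is read as pointing forwards.\<close>
  define d where "d \<longleftrightarrow> (s, t) \<in> parcs G"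
  define e where "e \<longleftrightarrow> (u, v) \<in> parcs G"
  have "{oriented d s t, (t, u), oriented e u v} \<subseteq> parcs G"
    using adj by (auto simp: d_def e_def adjacent_def oriented_def)
  with reducible_path[OF dist, of d e] chordless obtain x
    where x: "shortcut (parcs G) d e s t u v x"
    unfolding irreducible_path_def adjacent_def by blast
  have sx: "adj s x" and xv: "adj x v"
    using x by (auto simp: shortcut_def adjacent_def)
  have tu: "adj t u"
    using adj by (simp add: adjacent_def)
  note swap = edge_swap[OF adj(1)] edge_swap[OF adj(3)] edge_swap[OF sx] edge_swap[OF xv]
  consider "adj t x" "adj u x"
    | "{oriented e t x, (x, v)} \<subseteq> parcs G" | "{(s, x), oriented d x u} \<subseteq> parcs G"
    using x by (auto simp: shortcut_def)
  then have "null (edge s t + edge t u + edge u v - (edge s x + edge x v))"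
  proof cases
    case 1
    \<comment> \<open>The pentagon is cut into a fan of three triangles at \<open>x\<close>.\<close>
    have "null ((edge s t + edge t x - edge s x) + (edge t u + edge u x - edge t x)
        + (edge u v + edge v x - edge u x))"
      using 1 adj sx xv tu by (intro path_boundaries_add triangle_null) (auto simp: adjacent_sym)
    then show ?thesis by (simp add: swap algebra_simps)
  next
    case 2
    then have tx: "adj t x"
      by (auto simp: adjacent_def oriented_def split: if_splits)
    have tri: "null (edge s t + edge t x - edge s x)"
      using adj sx tx by (intro triangle_null)
    \<comment> \<open>The rest of the pentagon is the 4-cycle \<open>x, t, u, v\<close>. As a square
      it runs from \<open>t\<close> to \<open>v\<close> if \<open>e\<close> holds, and from
      \<open>x\<close> to \<open>u\<close> otherwise.\<close>
    show ?thesis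
    proof (cases e)
      case True
      then have "null (edge t u + edge u v - (edge t x + edge x v))"
        using 2 adj by (intro square_null) (auto simp: e_def oriented_def)
      from path_boundaries_add[OF tri this] show ?thesis by (simp add: algebra_simps)
    next
      case False
      then have "null (edge x t + edge t u - (edge x v + edge v u))"
        using 2 adj by (intro square_null) (auto simp: e_def oriented_def adjacent_def)
      from path_boundaries_add[OF tri this] show ?thesis
        by (simp add: swap edge_swap[OF tx] algebra_simps)
    qed
  next
    case 3
    then have xu: "adj x u"
      by (auto simp: adjacent_def oriented_def split: if_splits)
    have tri: "null (edge x u + edge u v - edge x v)"
      using adj xv xu by (intro triangle_null)
    \<comment> \<open>Here the 4-cycle is \<open>s, t, u, x\<close>. As a square it runs from
      \<open>s\<close> to \<open>u\<close> if \<open>d\<close> holds, and from \<open>t\<close> to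
      \<open>x\<close> otherwise; in the latter case it enters with a minus sign.\<close>
    show ?thesis
    proof (cases d)
      case True
      then have "null (edge s t + edge t u - (edge s x + edge x u))"
        using 3 adj by (intro square_null) (auto simp: d_def oriented_def)
      from path_boundaries_add[OF tri this] show ?thesis by (simp add: algebra_simps)
    next
      case False
      then have "null (edge t s + edge s x - (edge t u + edge u x))"
        using 3 adj by (intro square_null) (auto simp: d_def oriented_def adjacent_def)
      from path_boundaries_diff[OF tri this] show ?thesis
        by (simp add: swap edge_swap[OF xu] algebra_simps)
    qed
  qed
  with sx xv show thesis by (rule that)
qed

text \<open>The length bound counts vertices, so at least one of the three steps is saved; this
  drives the induction on closed walks.\<close>

lemma reduce_three_steps:
  assumes adj: "adj s t" "adj t u" "adj u v"
  obtains ws where "successively adj ws" "hd ws = s" "last ws = v" "ws \<noteq> []" "length ws \<le> 3"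
    "null (walk_chain (parcs G) [s, t, u, v] - walk_chain (parcs G) ws)"
proof -
  note swap = edge_swap[OF adj(1)] edge_swap[OF adj(2)] edge_swap[OF adj(3)]
  \<comment> \<open>The case \<open>s = v\<close> is covered by \<open>adj t v\<close>, which is
    then the first step reversed.\<close>
  consider "s = u" | "t = v" | "adj s u" | "adj t v"
    | "\<not> adj s u" "\<not> adj t v" "distinct [s, t, u, v]"
    using adj adjacent_sym[of "parcs G" s t] by (auto simp: adj_irrefl)
  then show thesis
  proof cases
    case 1
    then show thesis
      using that[of "[s, v]"] adj edge_swap[OF adj(1)] by simp
  next
    case 2
    then show thesis
      using that[of "[s, v]"] adj edge_swap[OF adj(2)] by simp
  next
    case 3
    then show thesis
      using that[of "[s, u, v]"] adj triangle_null[of s t u] by (simp add: algebra_simps)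
  next
    case 4
    then show thesis
      using that[of "[s, t, v]"] adj triangle_null[of t u v] by (simp add: algebra_simps)
  next
    case 5
    have "\<exists>x. adj s x \<and> adj x v \<and> null (edge s t + edge t u + edge u v - (edge s x + edge x v))"
    proof (cases "(t, u) \<in> parcs G")
      case True
      from shortcut_walk[OF adj(1) True adj(3) 5] show ?thesis by blast
    next
      case False
      then have ut: "(u, t) \<in> parcs G"
        using adj by (simp add: adjacent_def)
      \<comment> \<open>Traversed backwards, the path has its middle arc pointing forwards.\<close>
      obtain x where x: "adj v x" "adj x s"
        "null (edge v u + edge u t + edge t s - (edge v x + edge x s))"
        by (rule shortcut_walk[of v u t s]) (use ut adj 5 in \<open>auto simp: adjacent_sym\<close>)
      from path_boundaries_minus[OF x(3)]
      have "null (edge s t + edge t u + edge u v - (edge s x + edge x v))"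
        by (simp add: swap edge_swap[OF x(1)] edge_swap[OF x(2)] algebra_simps)
      with x show ?thesis by (auto simp: adjacent_sym)
    qed
    then obtain x where x: "adj s x" "adj x v"
      "null (edge s t + edge t u + edge u v - (edge s x + edge x v))"
      by blast
    show thesis
      by (rule that[of "[s, x, v]"]) (use x in \<open>simp_all add: add.assoc\<close>)
  qed
qed

lemma closed_walk_null:
  assumes "successively adj vs" "vs \<noteq> []" "hd vs = last vs"
  shows "null (walk_chain (parcs G) vs)"
  using assms
proof (induction vs rule: length_induct)
  case (1 vs)
  obtain a as where "vs = a # as"
    using 1(3) by (cases vs) auto
  \<comment> \<open>Two vertices would force a loop, and three describe a step out and back. Closed
    triangles already belong to the last case, with \<open>rest\<close> empty.\<close>
  then consider a where "vs = [a]" | a b where "vs = [a, b]" | a b c where "vs = [a, b, c]"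
    | s t u v rest where "vs = s # t # u # v # rest"
    by (metis list.exhaust)
  then show ?case
  proof cases
    case 2
    then show ?thesis using 1 by (auto simp: adj_irrefl)
  next
    case 3
    then show ?thesis using 1 edge_swap[of a b] by auto
  next
    case (4 s t u v rest)
    have adj: "adj s t" "adj t u" "adj u v" "successively adj (v # rest)"
      using 1(2) 4 by auto
    obtain ws where ws: "successively adj ws" "hd ws = s" "last ws = v" "ws \<noteq> []" "length ws \<le> 3"
      "null (walk_chain (parcs G) [s, t, u, v] - walk_chain (parcs G) ws)"
      using reduce_three_steps[OF adj(1-3)] by blast
    obtain us where us: "ws = us @ [v]"
      using ws by (metis append_butlast_last_id)
    have "null (walk_chain (parcs G) (us @ v # rest))"
    proof (rule 1(1)[rule_format])
      show "length (us @ v # rest) < length vs"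
        using ws(5) 4 us by simp
      show "successively adj (us @ v # rest)"
        using ws(1) adj(4) by (auto simp: us successively_append_iff)
      show "hd (us @ v # rest) = last (us @ v # rest)"
        using 1(4) 4 ws(2) us by (cases us) auto
    qed simp
    moreover have "walk_chain (parcs G) vs = walk_chain (parcs G) [s, t, u, v] + walk_chain (parcs G) (v # rest)"
      using walk_chain_append[of _ "[s, t, u]" v rest] by (simp add: 4)
    moreover have "walk_chain (parcs G) (us @ v # rest) = walk_chain (parcs G) ws + walk_chain (parcs G) (v # rest)"
      using walk_chain_append[of _ us v rest] us by simp
    ultimately show ?thesis
      using path_boundaries_add[OF ws(6), of "walk_chain (parcs G) (us @ v # rest)"] by simp
  qed simp
qed

section \<open>From closed walks to arbitrary 1-cycles\<close>

lemma walk_chain_rev: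
  "successively adj ws \<Longrightarrow> walk_chain (parcs G) (rev ws) = - walk_chain (parcs G) ws"
proof (induction ws rule: induct_list012)
  case (3 u v ws)
  then show ?case
    using walk_chain_append[of "parcs G" "rev ws" v "[u]"] by (simp add: edge_swap)
qed auto

text \<open>The predicate under \<open>SOME\<close> is the same for all vertices of a component of
  the underlying graph, so each component gets a single root.\<close>

definition root :: "'a \<Rightarrow> 'a" where
  "root v = (SOME r. adj\<^sup>*\<^sup>* r v)"

text \<open>An arbitrary choice for each vertex, in the role of the paths of a spanning
  tree.\<close>

definition root_walk :: "'a \<Rightarrow> 'a list" where
  "root_walk v = (SOME ws. successively adj ws \<and> ws \<noteq> [] \<and> hd ws = root v \<and> last ws = v)"

lemma root_walk:
  "successively adj (root_walk v)" "root_walk v \<noteq> []" "hd (root_walk v) = root v" "last (root_walk v) = v"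
proof -
  have "\<exists>ws. successively adj ws \<and> ws \<noteq> [] \<and> hd ws = r \<and> last ws = v" if "adj\<^sup>*\<^sup>* r v" for r
    using that
  proof (induction rule: rtranclp_induct)
    case base
    show ?case by (intro exI[of _ "[r]"]) simp
  next
    case (step u v)
    then obtain ws where "successively adj ws" "ws \<noteq> []" "hd ws = r" "last ws = u"
      by blast
    with step(2) show ?case
      by (intro exI[of _ "ws @ [v]"]) (simp add: successively_append_iff)
  qed
  moreover have "adj\<^sup>*\<^sup>* (root v) v"
    unfolding root_def by (rule someI[of _ v]) simp
  ultimately have "\<exists>ws. successively adj ws \<and> ws \<noteq> [] \<and> hd ws = root v \<and> last ws = v"
    by blast
  from someI_ex[OF this] show
    "successively adj (root_walk v)" "root_walk v \<noteq> []" "hd (root_walk v) = root v" "last (root_walk v) = v"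
    unfolding root_walk_def by auto
qed

lemma root_eq:
  assumes "adj u v"
  shows "root u = root v"
proof -
  have "adj\<^sup>*\<^sup>* r u \<longleftrightarrow> adj\<^sup>*\<^sup>* r v" for r
    using assms by (metis adjacent_sym rtranclp.rtrancl_into_rtrancl)
  then show ?thesis by (simp add: root_def)
qed

text \<open>This is the chain of a closed walk: out along \<open>root_walk u\<close>, across to
  \<open>v\<close>, and back along the reverse of \<open>root_walk v\<close>. It closes up because
  adjacent vertices have the same root.\<close>

lemma fundamental_cycle_null:
  assumes "adj u v"
  shows "null (walk_chain (parcs G) (root_walk u) + edge u v - walk_chain (parcs G) (root_walk v))"
proof -
  obtain us where us: "root_walk u = us @ [u]"
    using root_walk(2,4)[of u] by (metis append_butlast_last_id)
  obtain ws where ws: "rev (root_walk v) = v # ws"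
    using root_walk(2,4)[of v] by (metis append_butlast_last_id rev_eq_Cons_iff rev_rev_ident)
  have "null (walk_chain (parcs G) (root_walk u @ rev (root_walk v)))"
  proof (rule closed_walk_null)
    have "successively adj (rev (root_walk v))"
      using root_walk(1)[of v] by (simp add: adjacent_sym)
    then show "successively adj (root_walk u @ rev (root_walk v))"
      using root_walk[of u] root_walk[of v] assms by (simp add: successively_append_iff hd_rev)
    show "hd (root_walk u @ rev (root_walk v)) = last (root_walk u @ rev (root_walk v))"
      using root_walk[of u] root_walk[of v] root_eq[OF assms] by (simp add: last_rev)
  qed (simp add: root_walk)
  also have "walk_chain (parcs G) (root_walk u @ rev (root_walk v)) =
      walk_chain (parcs G) (root_walk u) + edge u v + walk_chain (parcs G) (rev (root_walk v))"
    using walk_chain_append[of "parcs G" us u "v # ws"] by (simp add: us ws)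
  finally show ?thesis
    by (simp add: walk_chain_rev root_walk)
qed

lemma path_cycles_subset_boundaries: "path_cycles G 1 \<subseteq> path_boundaries G 1"
proof
  fix z assume z: "z \<in> path_cycles G 1"
  \<comment> \<open>\<open>W\<close> takes lists because the generators of degree 0 are the
    one-vertex lists.\<close>
  define W where "W = (\<lambda>vs. walk_chain (parcs G) (root_walk (hd vs)))"
  \<comment> \<open>\<open>C\<close> closes each arc up to a cycle through a root; the added walks cancel on \<open>z\<close>,
      because they only depend on the boundary.\<close>
  define C where "C = (\<lambda>vs. W [hd vs] + frag_of vs - W [last vs])"
  have keys: "Poly_Mapping.keys z \<subseteq> allowed_seqs G 1" and "path_boundary z = 0"
    using z by (auto simp: path_cycles_def invariant_chains_def allowed_chains_def)
  have "null (frag_extend C z)"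
    using keys
  proof (induction rule: frag_induction)
    case (one vs)
    then obtain u v where vs: "vs = [u, v]" "(u, v) \<in> parcs G"
      by (auto simp: allowed_seqs_1)
    then have "adj u v" by (simp add: adjacent_def)
    from path_boundaries_add[OF fundamental_cycle_null[OF this] frag_of_edge_null[OF vs(2)]]
    show ?case by (simp add: vs C_def W_def algebra_simps)
  qed (auto simp: frag_extend_diff path_boundaries_diff)
  moreover have "frag_extend C z = z - frag_extend W (path_boundary z)"
    using keys
  proof (induction rule: frag_induction)
    case (one vs)
    then show ?case
      by (auto simp: allowed_seqs_1 path_boundary_edge C_def frag_extend_diff)
  qed (auto simp: frag_extend_diff path_boundary_diff)
  ultimately show "null z"
    using \<open>path_boundary z = 0\<close> by simp
qed

end

section \<open>Vanishing of the Betti number\<close>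

text \<open>The quotient has one element, so taking all coefficients 1 gives a relation on any
  finite set of its elements. Hence only the empty set is independent.\<close>

lemma path_betti_eq_0:
  assumes "path_cycles G m \<subseteq> path_boundaries G m"
  shows "path_betti G m = 0"
proof -
  let ?Z = "(path_chain_group G m)\<lparr>carrier := path_cycles G m\<rparr>"
  let ?H = "path_homology_group G m"
  interpret H: comm_group ?H
    by (rule comm_group_path_homology_group)
  have C: "group (path_chain_group G m)"
    by (simp add: path_chain_group_def)
  have Z: "group ?Z"
    by (rule subgroup.subgroup_is_group[OF subgroup_path_cycles C])
  have B: "subgroup (path_boundaries G m) ?Z"
    using C by (intro group.subgroup_incl subgroup_path_boundaries subgroup_path_cycles
        path_boundaries_subset_cycles)
  have trivial: "x = \<one>\<^bsub>?H\<^esub>" if "x \<in> carrier ?H" for x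
    using that assms subgroup.rcos_const[OF B Z]
    by (auto simp: path_homology_group_def FactGroup_def RCOSETS_def)
  have empty: "S = {}" if "int_independent ?H S" for S
  proof -
    have "finprod ?H (\<lambda>x. x [^]\<^bsub>?H\<^esub> (1::int)) S = \<one>\<^bsub>?H\<^esub>"
      using that trivial by (intro H.finprod_one_eqI) (auto simp: int_independent_def)
    moreover have "finprod ?H (\<lambda>x. x [^]\<^bsub>?H\<^esub> (1::int)) S = \<one>\<^bsub>?H\<^esub> \<longrightarrow> (\<forall>x\<in>S. (1::int) = 0)"
      using that unfolding int_independent_def by (elim conjE allE[of _ "\<lambda>_. 1"])
    ultimately show ?thesis by auto
  qed
  have "(SUP S \<in> {S. int_independent ?H S}. enat (card S)) \<le> 0"
  proof (rule SUP_least)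
    fix S assume "S \<in> {S. int_independent ?H S}"
    with empty have "S = {}" by blast
    then show "enat (card S) \<le> 0" by (simp add: zero_enat_def)
  qed
  then show ?thesis
    by (simp add: path_betti_def abelian_rank_def)
qed

lemma path_betti_1_posE:
  fixes G :: "'a::linorder pair_pre_digraph"
  assumes "pair_loopfree_digraph G" "path_betti G 1 > 0"
  obtains (edge) u v where "unfilled_edge (pverts G) (parcs G) u v"
  | (triangle) u v w where "unfilled_triangle (pverts G) (parcs G) u v w"
  | (path) d e s t u v where
      "distinct [s, t, u, v]" "irreducible_path (pverts G) (parcs G) d e s t u v"
proof -
  interpret pair_loopfree_digraph G by fact
  have "\<not> filled_digraph G"
    using path_betti_eq_0[OF filled_digraph.path_cycles_subset_boundaries] assms(2) by auto
  moreover have "filled_digraph G" if "\<not> thesis"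
  proof
    show "\<not> unfilled_edge (pverts G) (parcs G) u v" for u v
      using edge that by blast
    show "\<not> unfilled_triangle (pverts G) (parcs G) u v w" for u v w
      using triangle that by blast
    show "\<not> irreducible_path (pverts G) (parcs G) d e s t u v"
      if "distinct [s, t, u, v]" for s t u v d e
      using path that \<open>\<not> thesis\<close> by blast
  qed
  ultimately show thesis by blast
qed

section \<open>Random subsets\<close>

text \<open>The successes of independent trials, as a set; the default \<open>False\<close> keeps it
  inside \<open>A\<close>.\<close>

definition random_subset :: "'a set \<Rightarrow> real \<Rightarrow> 'a set pmf" where
  "random_subset A p = map_pmf Collect (Pi_pmf A False (\<lambda>_. bernoulli_pmf p))"

text \<open>\<open>B\<close> is any set of coordinates that determines the event. Independence then
  reduces to disjointness of such sets.\<close>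

definition depends_on :: "'a set \<Rightarrow> ('a set \<Rightarrow> bool) \<Rightarrow> bool" where
  "depends_on B P \<longleftrightarrow> (\<forall>E. P (E \<inter> B) \<longleftrightarrow> P E)"

lemma depends_onI: "(\<And>E. P (E \<inter> B) \<longleftrightarrow> P E) \<Longrightarrow> depends_on B P"
  by (simp add: depends_on_def)

lemma depends_onD: "depends_on B P \<Longrightarrow> E \<inter> B = E' \<inter> B \<Longrightarrow> P E \<longleftrightarrow> P E'"
  by (metis depends_on_def)

lemma depends_on_mono: "depends_on B P \<Longrightarrow> B \<subseteq> C \<Longrightarrow> depends_on C P"
  by (rule depends_onI, erule depends_onD) auto

lemma depends_on_Ball:
  assumes "\<And>i. i \<in> I \<Longrightarrow> depends_on (B i) (P i)"
  shows "depends_on (\<Union>i\<in>I. B i) (\<lambda>E. \<forall>i\<in>I. P i E)"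
proof (rule depends_onI)
  have "P i (E \<inter> (\<Union>i\<in>I. B i)) \<longleftrightarrow> P i E" if "i \<in> I" for i E
    using assms[OF that] by (rule depends_onD) (use that in auto)
  then show "(\<forall>i\<in>I. P i (E \<inter> (\<Union>i\<in>I. B i))) \<longleftrightarrow> (\<forall>i\<in>I. P i E)" for E
    by auto
qed

lemma measure_pair_pmf_Times:
  "measure_pmf.prob (pair_pmf M N) (A \<times> B) = measure_pmf.prob M A * measure_pmf.prob N B"
proof -
  \<comment> \<open>Cutting down to the supports makes both factors countable, as the product rule
    requires.\<close>
  have "measure_pmf.prob (pair_pmf M N) (A \<times> B) =
      measure_pmf.prob (pair_pmf M N) ((A \<inter> set_pmf M) \<times> (B \<inter> set_pmf N))"
    by (subst measure_Int_set_pmf[symmetric]) (simp add: Times_Int_Times)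
  also have "\<dots> = measure_pmf.prob M A * measure_pmf.prob N B"
    by (simp add: measure_pmf_prob_product countable_Int2 measure_Int_set_pmf)
  finally show ?thesis .
qed

lemma measure_pmf_prob_not:
  "measure_pmf.prob M {x. \<not> P x} = 1 - measure_pmf.prob M {x. P x}"
  using measure_pmf.prob_compl[of "{x. P x}" M] by (simp add: Collect_neg_eq Compl_eq_Diff_UNIV)

lemma set_random_subset: "finite A \<Longrightarrow> E \<in> set_pmf (random_subset A p) \<Longrightarrow> E \<subseteq> A"
  using set_Pi_pmf_subset[of A False "\<lambda>_. bernoulli_pmf p"] by (auto simp: random_subset_def)

lemma random_subset_Un:
  assumes "finite A" "finite B" "A \<inter> B = {}"
  shows "random_subset (A \<union> B) p =
    map_pmf (\<lambda>(E, F). E \<inter> A \<union> (F - A)) (pair_pmf (random_subset A p) (random_subset B p))"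
proof -
  have "Collect \<circ> (\<lambda>(f, g) x. if x \<in> A then f x else g x) =
      (\<lambda>(E, F). E \<inter> A \<union> (F - A)) \<circ> (\<lambda>(f, g). (Collect f, Collect g))"
    by (auto simp: fun_eq_iff)
  then show ?thesis
    unfolding random_subset_def Pi_pmf_union[OF assms] map_pair[symmetric]
    by (simp add: pmf.map_comp)
qed

text \<open>Split the trials at \<open>B\<close>: \<open>P\<close> reads only the part inside and
  \<open>Q\<close> only the part outside, so their conjunction is a rectangle in the product
  space.\<close>

lemma prob_random_subset_conj:
  assumes "finite A" "depends_on B P" "depends_on C Q" "B \<inter> C = {}"
  shows "measure_pmf.prob (random_subset A p) {E. P E \<and> Q E} =
    measure_pmf.prob (random_subset A p) {E. P E} * measure_pmf.prob (random_subset A p) {E. Q E}"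
proof -
  let ?M = "random_subset (A \<inter> B) p" and ?N = "random_subset (A - B) p"
  have split: "random_subset A p =
      map_pmf (\<lambda>(E, F). E \<inter> (A \<inter> B) \<union> (F - A \<inter> B)) (pair_pmf ?M ?N)"
    using random_subset_Un[of "A \<inter> B" "A - B" p] assms(1) by (simp add: Int_Diff_Un Int_Diff_disjoint)
  have product: "measure_pmf.prob (random_subset A p) {E. P' E \<and> Q' E} =
      measure_pmf.prob ?M {E. P' E} * measure_pmf.prob ?N {E. Q' E}"
    if P': "depends_on B P'" and Q': "depends_on C Q'" for P' Q'
  proof -
    \<comment> \<open>For \<open>P'\<close> the support matters: there \<open>F\<close> misses
      \<open>B\<close>.\<close>
    have "P' (E \<inter> (A \<inter> B) \<union> (F - A \<inter> B)) \<longleftrightarrow> P' E"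
      if "E \<in> set_pmf ?M" "F \<in> set_pmf ?N" for E F
      using P' set_random_subset[OF _ that(1)] set_random_subset[OF _ that(2)] assms(1)
      by (intro depends_onD[of B]) auto
    moreover have "Q' (E \<inter> (A \<inter> B) \<union> (F - A \<inter> B)) \<longleftrightarrow> Q' F" for E F
      using Q' assms(4) by (intro depends_onD[of C]) auto
    ultimately have "measure_pmf.prob (random_subset A p) {E. P' E \<and> Q' E} =
        measure_pmf.prob (pair_pmf ?M ?N) ({E. P' E} \<times> {F. Q' F})"
      unfolding split measure_map_pmf
      by (intro measure_prob_cong_0) (auto simp: pmf_eq_0_set_pmf)
    then show ?thesis
      by (simp add: measure_pair_pmf_Times)
  qed
  \<comment> \<open>Replacing one event by \<open>True\<close> identifies the two factors with the
    probabilities of \<open>P\<close> and \<open>Q\<close>.\<close>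
  have "depends_on B (\<lambda>_. True)" "depends_on C (\<lambda>_. True)"
    by (simp_all add: depends_on_def)
  with product[OF assms(2,3)] product[OF assms(2), of "\<lambda>_. True"]
    product[OF _ assms(3), of "\<lambda>_. True"]
  show ?thesis by simp
qed

lemma prob_random_subset_Ball:
  assumes "finite A" "finite I" "\<And>i. i \<in> I \<Longrightarrow> depends_on (B i) (P i)" "disjoint_family_on B I"
  shows "measure_pmf.prob (random_subset A p) {E. \<forall>i\<in>I. P i E} =
    (\<Prod>i\<in>I. measure_pmf.prob (random_subset A p) {E. P i E})"
  using assms(2-)
proof (induction rule: finite_induct)
  case (insert i I)
  have "measure_pmf.prob (random_subset A p) {E. P i E \<and> (\<forall>j\<in>I. P j E)} =
      measure_pmf.prob (random_subset A p) {E. P i E} *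
      measure_pmf.prob (random_subset A p) {E. \<forall>j\<in>I. P j E}"
    using assms(1) insert
    by (intro prob_random_subset_conj[of _ "B i" _ "\<Union>j\<in>I. B j"] depends_on_Ball)
       (auto simp: disjoint_family_on_insert)
  also have "measure_pmf.prob (random_subset A p) {E. \<forall>j\<in>I. P j E} =
      (\<Prod>j\<in>I. measure_pmf.prob (random_subset A p) {E. P j E})"
    using insert by (intro insert.IH) (auto simp: disjoint_family_on_insert)
  finally show ?case using insert by simp
qed simp

lemma prob_random_subset_literals:
  assumes "finite A" "S \<subseteq> A" "T \<subseteq> A" "S \<inter> T = {}" "0 \<le> p" "p \<le> 1"
  shows "measure_pmf.prob (random_subset A p) {E. S \<subseteq> E \<and> T \<inter> E = {}} =
    p ^ card S * (1 - p) ^ card T"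
proof -
  have fin: "finite S" "finite T"
    using assms(1-3) by (auto intro: finite_subset)
  have mem: "measure_pmf.prob (random_subset A p) {E. x \<in> E} = p" if "x \<in> A" for x
  proof -
    have "measure_pmf.prob (random_subset A p) {E. x \<in> E} =
        measure_pmf.prob (map_pmf (\<lambda>f. f x) (Pi_pmf A False (\<lambda>_. bernoulli_pmf p))) {True}"
      by (simp add: random_subset_def vimage_def)
    also have "\<dots> = p"
      using assms that by (simp add: Pi_pmf_component measure_pmf_single)
    finally show ?thesis .
  qed
  have not_mem: "measure_pmf.prob (random_subset A p) {E. x \<notin> E} = 1 - p" if "x \<in> A" for x
    by (simp add: measure_pmf_prob_not mem that)
  have "{E. S \<subseteq> E \<and> T \<inter> E = {}} = {E. \<forall>x\<in>S \<union> T. if x \<in> S then x \<in> E else x \<notin> E}"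
    using assms(4) by (auto split: if_splits)
  also have "measure_pmf.prob (random_subset A p) \<dots> =
      (\<Prod>x\<in>S \<union> T. measure_pmf.prob (random_subset A p) {E. if x \<in> S then x \<in> E else x \<notin> E})"
    using assms(1) fin
    by (intro prob_random_subset_Ball[where B = "\<lambda>x. {x}"])
       (auto simp: depends_on_def disjoint_family_on_def)
  also have "\<dots> = (\<Prod>x\<in>S \<union> T. if x \<in> S then p else 1 - p)"
    by (intro prod.cong) (use assms(2,3) mem not_mem in auto)
  also have "\<dots> = p ^ card S * (\<Prod>x\<in>T. if x \<in> S then p else 1 - p)"
    using fin assms(4) by (simp add: prod.union_disjoint)
  also have "(\<Prod>x\<in>T. if x \<in> S then p else 1 - p) = (\<Prod>x\<in>T. 1 - p)"
    by (intro prod.cong) (use assms(4) in auto)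
  finally show ?thesis by simp
qed

text \<open>The common shape of all obstructions: some arcs are prescribed, and a family of further
  conditions reads arcs disjoint from these and from each other.\<close>

lemma prob_random_subset:
  assumes "finite A" "S \<subseteq> A" "T \<subseteq> A" "S \<inter> T = {}" "0 \<le> p" "p \<le> 1"
    and "finite I" "\<And>i. i \<in> I \<Longrightarrow> depends_on (B i) (P i)" "disjoint_family_on B I"
    and "\<And>i. i \<in> I \<Longrightarrow> B i \<inter> (S \<union> T) = {}"
  shows "measure_pmf.prob (random_subset A p) {E. S \<subseteq> E \<and> T \<inter> E = {} \<and> (\<forall>i\<in>I. P i E)} =
    p ^ card S * (1 - p) ^ card T * (\<Prod>i\<in>I. measure_pmf.prob (random_subset A p) {E. P i E})"
proof -
  have "measure_pmf.prob (random_subset A p) {E. (S \<subseteq> E \<and> T \<inter> E = {}) \<and> (\<forall>i\<in>I. P i E)} =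
    measure_pmf.prob (random_subset A p) {E. S \<subseteq> E \<and> T \<inter> E = {}} *
    measure_pmf.prob (random_subset A p) {E. \<forall>i\<in>I. P i E}"
  proof (rule prob_random_subset_conj)
    show "depends_on (S \<union> T) (\<lambda>E. S \<subseteq> E \<and> T \<inter> E = {})"
      by (rule depends_onI) auto
    show "depends_on (\<Union>i\<in>I. B i) (\<lambda>E. \<forall>i\<in>I. P i E)"
      using assms by (intro depends_on_Ball)
    show "(S \<union> T) \<inter> (\<Union>i\<in>I. B i) = {}"
      using assms(10) by blast
  qed (use assms in auto)
  then show ?thesis
    using assms by (simp add: prob_random_subset_literals prob_random_subset_Ball[of A I B P])
qed

section \<open>Probabilities of the local obstructions\<close>

definition complete_arcs :: "'a set \<Rightarrow> 'a rel" where
  "complete_arcs V = {(u, v). u \<in> V \<and> v \<in> V \<and> u \<noteq> v}"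

lemma finite_complete_arcs: "finite V \<Longrightarrow> finite (complete_arcs V)"
  by (rule finite_subset[of _ "V \<times> V"]) (auto simp: complete_arcs_def)

lemma prob_cone_free:
  assumes "finite V" "K \<subseteq> V" "S \<subseteq> complete_arcs K" "0 \<le> p" "p \<le> 1" "K \<noteq> {}"
  shows "measure_pmf.prob (random_subset (complete_arcs V) p) {E. S \<subseteq> E \<and> cone_free V E K} =
    p ^ card S * (1 - p ^ card K) ^ (2 * (card V - card K))"
proof -
  let ?prob = "measure_pmf.prob (random_subset (complete_arcs V) p)"
  \<comment> \<open>One cone for each apex and direction; no two of them share an arc.\<close>
  define cone where "cone = (\<lambda>(x, outgoing). if outgoing then {x} \<times> K else K \<times> {x})"
  let ?I = "(V - K) \<times> (UNIV :: bool set)"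
  have cone: "?prob {E. \<not> cone i \<subseteq> E} = 1 - p ^ card K" if "i \<in> ?I" for i
  proof -
    have "cone i \<subseteq> complete_arcs V" "card (cone i) = card K"
      using that assms(2) by (auto simp: cone_def complete_arcs_def card_cartesian_product split: if_splits)
    then have "?prob {E. cone i \<subseteq> E} = p ^ card K"
      using prob_random_subset_literals[of "complete_arcs V" "cone i" "{}" p] assms
      by (simp add: finite_complete_arcs)
    then show ?thesis
      by (simp add: measure_pmf_prob_not)
  qed
  have "{E. S \<subseteq> E \<and> cone_free V E K} = {E. S \<subseteq> E \<and> {} \<inter> E = {} \<and> (\<forall>i\<in>?I. \<not> cone i \<subseteq> E)}"
    by (auto simp: cone_free_def cone_def)
  also have "?prob \<dots> = p ^ card S * (1 - p) ^ card ({} :: ('a \<times> 'a) set) *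
      (\<Prod>i\<in>?I. ?prob {E. \<not> cone i \<subseteq> E})"
  proof (rule prob_random_subset[where B = cone])
    show "S \<subseteq> complete_arcs V"
      using assms by (auto simp: complete_arcs_def)
    show "depends_on (cone i) (\<lambda>E. \<not> cone i \<subseteq> E)" for i
      by (rule depends_onI) auto
    show "disjoint_family_on cone ?I"
      using assms by (auto simp: disjoint_family_on_def cone_def)
    show "cone i \<inter> (S \<union> {}) = {}" if "i \<in> ?I" for i
      using assms that by (auto simp: cone_def complete_arcs_def split: if_splits)
  qed (use assms finite_complete_arcs in auto)
  also have "(\<Prod>i\<in>?I. ?prob {E. \<not> cone i \<subseteq> E}) = (1 - p ^ card K) ^ card ?I"
    by (simp add: cone del: mem_Sigma_iff)
  also have "card ?I = 2 * (card V - card K)"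
    using assms by (simp add: card_cartesian_product card_Diff_subset finite_subset)
  finally show ?thesis by simp
qed

lemma prob_unfilled_edge:
  assumes "finite V" "u \<in> V" "v \<in> V" "u \<noteq> v" "0 \<le> p" "p \<le> 1"
  shows "measure_pmf.prob (random_subset (complete_arcs V) p) {E. unfilled_edge V E u v} =
    p ^ 2 * (1 - p ^ 2) ^ (2 * (card V - 2))"
  unfolding unfilled_edge_def using assms
  by (subst prob_cone_free) (auto simp: complete_arcs_def numeral_2_eq_2)

lemma prob_unfilled_triangle:
  assumes "finite V" "u \<in> V" "v \<in> V" "w \<in> V" "distinct [u, v, w]" "0 \<le> p" "p \<le> 1"
  shows "measure_pmf.prob (random_subset (complete_arcs V) p) {E. unfilled_triangle V E u v w} =
    p ^ 3 * (1 - p ^ 3) ^ (2 * (card V - 3))"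
  unfolding unfilled_triangle_def using assms
  by (subst prob_cone_free) (auto simp: complete_arcs_def card_insert_if numeral_3_eq_3)

section \<open>Shortcuts and irreducible paths\<close>

lemma depends_on_adjacent: "depends_on {(u, v), (v, u)} (\<lambda>E. adjacent E u v)"
  by (rule depends_onI) (auto simp: adjacent_def)

lemma prob_adjacent:
  assumes "finite V" "u \<in> V" "v \<in> V" "u \<noteq> v" "0 \<le> p" "p \<le> 1"
  shows "measure_pmf.prob (random_subset (complete_arcs V) p) {E. adjacent E u v} = 1 - (1 - p)\<^sup>2"
proof -
  let ?prob = "measure_pmf.prob (random_subset (complete_arcs V) p)"
  have "?prob {E. {(u, v), (v, u)} \<inter> E = {}} = (1 - p)\<^sup>2"
    using assms finite_complete_arcs[OF assms(1)]
      prob_random_subset_literals[of "complete_arcs V" "{}" "{(u, v), (v, u)}" p]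
    by (simp add: complete_arcs_def power2_eq_square)
  moreover have "{E. adjacent E u v} = {E. \<not> {(u, v), (v, u)} \<inter> E = {}}"
    by (auto simp: adjacent_def)
  ultimately show ?thesis
    by (simp only: measure_pmf_prob_not)
qed

text \<open>The disjuncts of \<open>shortcut\<close> overlap. Disjoint cases are: \<open>x\<close>
  adjacent to all four vertices, to all but \<open>u\<close> with the first square, or to all but
  \<open>t\<close> with the second square.\<close>

lemma prob_shortcut:
  assumes "finite V" "{s, t, u, v, x} \<subseteq> V" "distinct [s, t, u, v, x]" "0 \<le> p" "p \<le> 1"
  shows "measure_pmf.prob (random_subset (complete_arcs V) p) {E. shortcut E d e s t u v x} =
    (1 - (1 - p)\<^sup>2) ^ 4 + 2 * (p\<^sup>2 * (1 - p)\<^sup>2 * (1 - (1 - p)\<^sup>2))"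
proof -
  let ?prob = "measure_pmf.prob (random_subset (complete_arcs V) p)"
  let ?all = "{E. \<forall>w\<in>{s, t, u, v}. adjacent E w x}"
  \<comment> \<open>\<open>S\<close> holds the two arcs of the square at \<open>x\<close>,
    \<open>a\<close> is the vertex not joined to \<open>x\<close>, and \<open>b\<close> is joined to
    it in any direction.\<close>
  let ?square = "\<lambda>S a b. {E. S \<subseteq> E \<and> {(a, x), (x, a)} \<inter> E = {} \<and> (\<forall>w\<in>{b}. adjacent E w x)}"
  have square: "?prob (?square S a b) = p\<^sup>2 * (1 - p)\<^sup>2 * (1 - (1 - p)\<^sup>2)"
    if "S \<subseteq> complete_arcs V" "card S = 2" "S \<inter> {(a, x), (x, a), (b, x), (x, b)} = {}"
      "a \<in> V" "b \<in> V" "distinct [a, b, x]" for S a b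
  proof -
    have "?prob (?square S a b) = p ^ card S * (1 - p) ^ card {(a, x), (x, a)} *
        (\<Prod>w\<in>{b}. ?prob {E. adjacent E w x})"
      using that assms depends_on_adjacent[of b x] finite_complete_arcs[OF assms(1)]
      by (intro prob_random_subset[where B = "\<lambda>w. {(w, x), (x, w)}"])
         (auto simp: complete_arcs_def disjoint_family_on_def)
    also have "card {(a, x), (x, a)} = 2"
      using that by simp
    finally show ?thesis
      using that assms by (simp add: prob_adjacent)
  qed
  have "{E. shortcut E d e s t u v x} =
      ?all \<union> (?square {oriented e t x, (x, v)} u s \<union> ?square {(s, x), oriented d x u} t v)"
    by (auto simp: shortcut_def adjacent_def oriented_def split: if_splits)
  moreover have "?all \<inter> (?square {oriented e t x, (x, v)} u s \<union> ?square {(s, x), oriented d x u} t v) = {}"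
    by (auto simp: adjacent_def)
  moreover have "?square {oriented e t x, (x, v)} u s \<inter> ?square {(s, x), oriented d x u} t v = {}"
    by (auto simp: oriented_def split: if_splits)
  ultimately have "?prob {E. shortcut E d e s t u v x} = ?prob ?all +
      (?prob (?square {oriented e t x, (x, v)} u s) + ?prob (?square {(s, x), oriented d x u} t v))"
    by (simp add: measure_pmf.finite_measure_Union)
  also have "?prob ?all = (1 - (1 - p)\<^sup>2) ^ 4"
  proof -
    have "?prob ?all = (\<Prod>w\<in>{s, t, u, v}. ?prob {E. adjacent E w x})"
      using assms finite_complete_arcs depends_on_adjacent
      by (intro prob_random_subset_Ball[where B = "\<lambda>w. {(w, x), (x, w)}"])
         (auto simp: disjoint_family_on_def)
    also have "\<dots> = (\<Prod>w\<in>{s, t, u, v}. 1 - (1 - p)\<^sup>2)"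
      using assms by (intro prod.cong refl prob_adjacent) auto
    also have "\<dots> = (1 - (1 - p)\<^sup>2) ^ 4"
      using assms by (simp add: eval_nat_numeral)
    finally show ?thesis .
  qed
  also have "?prob (?square {oriented e t x, (x, v)} u s) = p\<^sup>2 * (1 - p)\<^sup>2 * (1 - (1 - p)\<^sup>2)"
    using assms by (intro square) (auto simp: oriented_def complete_arcs_def)
  also have "?prob (?square {(s, x), oriented d x u} t v) = p\<^sup>2 * (1 - p)\<^sup>2 * (1 - (1 - p)\<^sup>2)"
    using assms by (intro square) (auto simp: oriented_def complete_arcs_def)
  finally show ?thesis by simp
qed


text \<open>The condition at \<open>x\<close> reads only arcs between \<open>x\<close> and the path,
  so the conditions are independent of each other and of the seven prescribed arcs.\<close>

lemma prob_irreducible_path: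
  assumes "finite V" "{s, t, u, v} \<subseteq> V" "distinct [s, t, u, v]" "0 \<le> p" "p \<le> 1"
  shows "measure_pmf.prob (random_subset (complete_arcs V) p) {E. irreducible_path V E d e s t u v} =
    p ^ 3 * (1 - p) ^ 4 *
    (1 - ((1 - (1 - p)\<^sup>2) ^ 4 + 2 * (p\<^sup>2 * (1 - p)\<^sup>2 * (1 - (1 - p)\<^sup>2)))) ^ (card V - 4)"
proof -
  let ?prob = "measure_pmf.prob (random_subset (complete_arcs V) p)"
  let ?S = "{oriented d s t, (t, u), oriented e u v}" and ?T = "{(s, u), (u, s), (t, v), (v, t)}"
  let ?I = "V - {s, t, u, v}"
  let ?B = "\<lambda>x. {s, t, u, v} \<times> {x} \<union> {x} \<times> {s, t, u, v}"
  have not_shortcut: "?prob {E. \<not> shortcut E d e s t u v x} =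
      1 - ((1 - (1 - p)\<^sup>2) ^ 4 + 2 * (p\<^sup>2 * (1 - p)\<^sup>2 * (1 - (1 - p)\<^sup>2)))" if "x \<in> ?I" for x
    unfolding measure_pmf_prob_not using that assms by (subst prob_shortcut) auto
  have "?prob {E. irreducible_path V E d e s t u v} =
      p ^ card ?S * (1 - p) ^ card ?T * (\<Prod>x\<in>?I. ?prob {E. \<not> shortcut E d e s t u v x})"
    unfolding irreducible_path_def
  proof (rule prob_random_subset[where B = ?B])
    show "depends_on (?B x) (\<lambda>E. \<not> shortcut E d e s t u v x)" for x
      by (rule depends_onI) (auto simp: shortcut_def adjacent_def oriented_def)
    show "disjoint_family_on ?B ?I"
      by (auto simp: disjoint_family_on_def)
    show "?B x \<inter> (?S \<union> ?T) = {}" if "x \<in> ?I" for x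
      using that by (auto simp: oriented_def)
  qed (use assms finite_complete_arcs in \<open>auto simp: complete_arcs_def oriented_def\<close>)
  also have "card ?S = 3"
    using assms(3) by (auto simp: oriented_def)
  also have "card ?T = 4"
    using assms(3) by auto
  also have "(\<Prod>x\<in>?I. ?prob {E. \<not> shortcut E d e s t u v x}) =
      (1 - ((1 - (1 - p)\<^sup>2) ^ 4 + 2 * (p\<^sup>2 * (1 - p)\<^sup>2 * (1 - (1 - p)\<^sup>2)))) ^ card ?I"
    by (simp add: not_shortcut)
  also have "card ?I = card V - 4"
    using assms by (simp add: card_Diff_subset)
  finally show ?thesis .
qed

text \<open>
  The polynomial \<open>r\<close> has coefficients \<open>0, 0, 0, 4, 26, 40, 26, 8, 1\<close> in the basis
  \<open>p\<^sup>l (1 - p)\<^sup>8\<^sup>-\<^sup>l\<close>, which dominate every row of the matrix.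
\<close>

lemma Q_matrix_bound:
  fixes p :: real
  defines "r \<equiv> (1 - (1 - p)\<^sup>2) ^ 4 + 2 * (p\<^sup>2 * (1 - p)\<^sup>2 * (1 - (1 - p)\<^sup>2))"
  assumes "0 \<le> p" "p \<le> 1" "m \<le> 3"
  shows "(\<Sum>l=0..8. Q_matrix ! m ! l * p ^ l * (1 - p) ^ (8 - l)) \<le> r" "r \<le> 1"
proof -
  define q where "q = 1 - p"
  define N where "N = (\<lambda>l::nat. p ^ l * q ^ (8 - l))"
  have pq: "p + q = 1" and N: "0 \<le> N l" for l
    using assms by (simp_all add: q_def N_def)
  have "1 - q\<^sup>2 = (p + q)\<^sup>2 - q\<^sup>2"
    by (simp add: pq)
  also have "\<dots> = p * (p + 2 * q)"
    by (simp add: power2_eq_square algebra_simps)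
  \<comment> \<open>The second term has degree 6; the factor \<open>(p + q)\<^sup>2 = 1\<close>
    makes it homogeneous of degree 8.\<close>
  finally have "r = (p * (p + 2 * q)) ^ 4 + 2 * (p\<^sup>2 * q\<^sup>2 * (p * (p + 2 * q))) * (p + q)\<^sup>2"
    by (simp add: r_def flip: q_def) (simp add: pq)
  also have "\<dots> = 4 * N 3 + 26 * N 4 + 40 * N 5 + 26 * N 6 + 8 * N 7 + N 8"
    by (simp add: N_def eval_nat_numeral algebra_simps)
  finally have r: "r = 4 * N 3 + 26 * N 4 + 40 * N 5 + 26 * N 6 + 8 * N 7 + N 8" .
  have "(\<Sum>l=0..8. Q_matrix ! m ! l * p ^ l * (1 - p) ^ (8 - l)) = (\<Sum>l=0..8. Q_matrix ! m ! l * N l)"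
    by (simp add: N_def q_def mult.assoc)
  also have "\<dots> \<le> r"
  proof -
    have sum_9: "(\<Sum>l=0..8. f l) = f 0 + f 1 + f 2 + f 3 + f 4 + f 5 + f 6 + f 7 + f 8"
      for f :: "nat \<Rightarrow> real"
      by (simp add: eval_nat_numeral)
    consider "m = 0" | "m = 1" | "m = 2" | "m = 3"
      using assms by linarith
    then show ?thesis
      using N[of 3] N[of 4] N[of 5] N[of 6] N[of 7] N[of 8]
      by cases (simp_all add: r sum_9 Q_matrix_def)
  qed
  finally show "(\<Sum>l=0..8. Q_matrix ! m ! l * p ^ l * (1 - p) ^ (8 - l)) \<le> r" .
  \<comment> \<open>The coefficients of \<open>r\<close> are at most the binomial coefficients of
    the expansion of 1.\<close>
  have "1 = (p + q) ^ 8" by (simp add: pq)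
  also have "\<dots> = N 0 + 8 * N 1 + 28 * N 2 + 56 * N 3 + 70 * N 4 + 56 * N 5 + 28 * N 6 + 8 * N 7 + N 8"
    by (simp add: N_def eval_nat_numeral algebra_simps)
  finally show "r \<le> 1"
    using r N[of 0] N[of 1] N[of 2] N[of 3] N[of 4] N[of 5] N[of 6] N[of 7] N[of 8] by linarith
qed

section \<open>The union bound\<close>

lemma random_digraph_eq:
  "random_digraph n p =
    map_pmf (\<lambda>E. \<lparr>pverts = {1..n}, parcs = E\<rparr>) (random_subset (complete_arcs {1..n}) p)"
  by (simp add: random_digraph_def random_subset_def complete_arcs_def pmf.map_comp comp_def)

text \<open>For \<open>k > card A\<close> both sides vanish, which takes care of small
  \<open>n\<close>.\<close>

lemma card_distinct_lists:
  assumes "finite A"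
  shows "card {xs. length xs = k \<and> distinct xs \<and> set xs \<subseteq> A} = (card A choose k) * fact k"
proof (cases "k \<le> card A")
  case True
  have "(card A choose k) * fact k * fact (card A - k) = fact (card A)"
    using binomial_fact_lemma[OF True] by (simp add: ac_simps)
  also have "\<dots> = \<Prod>{card A - k + 1..card A} * fact (card A - k)"
    using fact_eq_fact_times[of "card A - k" "card A"] by (simp add: mult.commute)
  finally have "(card A choose k) * fact k = \<Prod>{card A - k + 1..card A}"
    by simp
  with card_lists_distinct_length_eq[OF assms True] show ?thesis by simp
next
  case False
  then have "{xs. length xs = k \<and> distinct xs \<and> set xs \<subseteq> A} = {}"
    using card_mono[OF assms] by (auto simp flip: distinct_card)
  with False show ?thesis
    by (simp only: card.empty binomial_eq_0 not_le mult_0)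
qed

theorem theoremA8:
  fixes n :: nat and p :: real
  assumes "n \<ge> 1" and "0 \<le> p" and "p \<le> 1"
  shows "measure_pmf.prob (random_digraph n p) {G. path_betti G 1 > 0}
    \<le> real (n choose 4) * fact 4 *
        (\<Sum>m=0..3. p ^ 3 * (1 - p) ^ (c_exponents ! m) *
           (1 - (\<Sum>l=0..8. Q_matrix ! m ! l * p ^ l * (1 - p) ^ (8 - l))) ^ (n - 4))
      + real (n choose 2) * p ^ 2 * (1 - p ^ 2) ^ (2 * n - 4)
      + 2 * real (n choose 3) * p ^ 3 * (1 - p ^ 3) ^ (2 * n - 6)"
proof -
  let ?V = "{1..n}"
  let ?M = "random_subset (complete_arcs ?V) p"
  define r where "r = (1 - (1 - p)\<^sup>2) ^ 4 + 2 * (p\<^sup>2 * (1 - p)\<^sup>2 * (1 - (1 - p)\<^sup>2))"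
  define edges where "edges = {K. K \<subseteq> ?V \<and> card K = 2}"
  define triangles where "triangles = {K. K \<subseteq> ?V \<and> card K = 3}"
  define paths where
    "paths = {xs. length xs = 4 \<and> distinct xs \<and> set xs \<subseteq> ?V} \<times> (UNIV :: (bool \<times> bool) set)"
  define edge_event where "edge_event = (\<lambda>K. {E. \<exists>u v. K = {u, v} \<and> unfilled_edge ?V E u v})"
  define triangle_event where
    "triangle_event = (\<lambda>K. {E. \<exists>u v w. K = {u, v, w} \<and> unfilled_triangle ?V E u v w})"
  define path_event where
    "path_event = (\<lambda>(xs, d, e). {E. irreducible_path ?V E d e (xs ! 0) (xs ! 1) (xs ! 2) (xs ! 3)})"

  have "finite {xs. length xs = 4 \<and> distinct xs \<and> set xs \<subseteq> ?V}"
    by (rule finite_subset[OF _ finite_lists_length_eq[of ?V 4]]) auto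
  then have finite: "finite edges" "finite triangles" "finite paths"
    by (simp_all add: edges_def triangles_def paths_def)
  have card: "card edges = n choose 2" "card triangles = n choose 3"
    "card paths = (n choose 4) * fact 4 * 4"
    by (simp_all add: edges_def triangles_def paths_def n_subsets card_cartesian_product
        card_distinct_lists UNIV_Times_UNIV[symmetric] del: UNIV_Times_UNIV)

  have edge_bound: "measure_pmf.prob ?M (edge_event K) \<le> p ^ 2 * (1 - p ^ 2) ^ (2 * (n - 2))"
    if "K \<in> edges" for K
  proof -
    from that obtain u v where K: "K = {u, v}" "u \<noteq> v" "u \<in> ?V" "v \<in> ?V"
      by (auto simp: edges_def card_2_iff)
    \<comment> \<open>The obstruction is symmetric in its vertices, so one ordering represents
      \<open>K\<close>.\<close>
    have "edge_event K \<subseteq> {E. unfilled_edge ?V E u v}"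
      using K by (auto simp: edge_event_def unfilled_edge_def doubleton_eq_iff insert_commute)
    then have "measure_pmf.prob ?M (edge_event K) \<le> measure_pmf.prob ?M {E. unfilled_edge ?V E u v}"
      by (intro measure_pmf.finite_measure_mono) auto
    with prob_unfilled_edge[of ?V u v p] K assms show ?thesis by simp
  qed

  have triangle_bound: "measure_pmf.prob ?M (triangle_event K) \<le> 2 * (p ^ 3 * (1 - p ^ 3) ^ (2 * (n - 3)))"
    if "K \<in> triangles" for K
  proof -
    from that obtain u v w where K: "K = {u, v, w}" "distinct [u, v, w]" "u \<in> ?V" "v \<in> ?V" "w \<in> ?V"
      by (auto simp: triangles_def card_3_iff)
    \<comment> \<open>Up to rotation, a cyclic triangle on \<open>K\<close> has one of two senses;
      hence the factor 2.\<close>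
    have "triangle_event K \<subseteq> {E. unfilled_triangle ?V E u v w} \<union> {E. unfilled_triangle ?V E u w v}"
    proof
      fix E assume "E \<in> triangle_event K"
      then obtain x y z where xyz: "{u, v, w} = {x, y, z}" "unfilled_triangle ?V E x y z"
        by (auto simp: triangle_event_def K)
      then have "x \<in> {u, v, w}" "y \<in> {u, v, w}" "z \<in> {u, v, w}" "u \<in> {x, y, z}" "v \<in> {x, y, z}" "w \<in> {x, y, z}"
        by auto
      with K(2) xyz(2) show "E \<in> {E. unfilled_triangle ?V E u v w} \<union> {E. unfilled_triangle ?V E u w v}"
        by (auto simp: unfilled_triangle_def insert_commute)
    qed
    then have "measure_pmf.prob ?M (triangle_event K) \<le>
        measure_pmf.prob ?M {E. unfilled_triangle ?V E u v w} + measure_pmf.prob ?M {E. unfilled_triangle ?V E u w v}"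
      by (intro order.trans[OF measure_pmf.finite_measure_mono measure_Un_le]) auto
    with prob_unfilled_triangle[of ?V u v w p] prob_unfilled_triangle[of ?V u w v p] K assms
    show ?thesis by auto
  qed

  have path_bound: "measure_pmf.prob ?M (path_event y) \<le> p ^ 3 * (1 - p) ^ 4 * (1 - r) ^ (n - 4)"
    if "y \<in> paths" for y
  proof -
    obtain xs d e where xs: "y = (xs, d, e)" "length xs = 4" "distinct xs" "set xs \<subseteq> ?V"
      using \<open>y \<in> paths\<close> by (cases y) (auto simp: paths_def)
    obtain s t u v where "xs = [s, t, u, v]"
      using xs(2) by (auto simp: length_Suc_conv numeral_eq_Suc)
    with xs have y: "y = ([s, t, u, v], d, e)" "distinct [s, t, u, v]" "{s, t, u, v} \<subseteq> ?V"
      by auto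
    show ?thesis
      using prob_irreducible_path[OF _ y(3,2) assms(2,3), of d e]
      by (simp add: path_event_def y(1) r_def numeral_eq_Suc)
  qed

  \<comment> \<open>On the support the arcs avoid loops, so the deterministic result
    applies.\<close>
  have cover: "{E. path_betti \<lparr>pverts = ?V, parcs = E\<rparr> 1 > 0} \<inter> set_pmf ?M \<subseteq>
      (\<Union>K\<in>edges. edge_event K) \<union> (\<Union>K\<in>triangles. triangle_event K) \<union> (\<Union>y\<in>paths. path_event y)"
  proof (rule subsetI, elim IntE CollectE)
    fix E
    let ?G = "\<lparr>pverts = ?V, parcs = E\<rparr>"
    assume betti: "path_betti ?G 1 > 0" and "E \<in> set_pmf ?M"
    then have E: "E \<subseteq> complete_arcs ?V"
      by (simp add: set_random_subset finite_complete_arcs)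
    then have "pair_loopfree_digraph ?G"
      by unfold_locales (auto simp: complete_arcs_def)
    then show "E \<in> (\<Union>K\<in>edges. edge_event K) \<union> (\<Union>K\<in>triangles. triangle_event K) \<union> (\<Union>y\<in>paths. path_event y)"
      using betti
    proof (cases rule: path_betti_1_posE)
      case (edge u v)
      then have "{u, v} \<in> edges"
        using E by (auto simp: unfilled_edge_def complete_arcs_def edges_def card_insert_if)
      with edge show ?thesis by (auto simp: edge_event_def)
    next
      case (triangle u v w)
      then have "{u, v, w} \<in> triangles"
        using E by (auto simp: unfilled_triangle_def complete_arcs_def triangles_def card_insert_if)
      with triangle show ?thesis by (auto simp: triangle_event_def)
    next
      case (path d e s t u v)
      then have "([s, t, u, v], d, e) \<in> paths"
        using E by (auto simp: irreducible_path_def complete_arcs_def paths_def oriented_def split: if_splits)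
      moreover have "E \<in> path_event ([s, t, u, v], d, e)"
        using path by (simp add: path_event_def numeral_eq_Suc)
      ultimately show ?thesis by blast
    qed
  qed

  have UN_bound: "measure_pmf.prob ?M (\<Union>i\<in>I. A i) \<le> real (card I) * b"
    if "finite I" "\<And>i. i \<in> I \<Longrightarrow> measure_pmf.prob ?M (A i) \<le> b" for I :: "'i set" and A b
  proof -
    have "measure_pmf.prob ?M (\<Union>i\<in>I. A i) \<le> (\<Sum>i\<in>I. measure_pmf.prob ?M (A i))"
      using that by (intro measure_pmf.finite_measure_subadditive_finite) auto
    also have "\<dots> \<le> real (card I) * b"
      using that by (intro sum_bounded_above)
    finally show ?thesis .
  qed

  have "measure_pmf.prob (random_digraph n p) {G. path_betti G 1 > 0} =
      measure_pmf.prob ?M ({E. path_betti \<lparr>pverts = ?V, parcs = E\<rparr> 1 > 0} \<inter> set_pmf ?M)"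
    by (simp add: random_digraph_eq measure_Int_set_pmf vimage_def)
  also have "\<dots> \<le> measure_pmf.prob ?M
      ((\<Union>K\<in>edges. edge_event K) \<union> (\<Union>K\<in>triangles. triangle_event K) \<union> (\<Union>y\<in>paths. path_event y))"
    using cover by (intro measure_pmf.finite_measure_mono) auto
  also have "\<dots> \<le> measure_pmf.prob ?M (\<Union>K\<in>edges. edge_event K)
      + measure_pmf.prob ?M (\<Union>K\<in>triangles. triangle_event K) + measure_pmf.prob ?M (\<Union>y\<in>paths. path_event y)"
    by (intro order.trans[OF measure_Un_le] add_right_mono
        measure_Un_le) auto
  also have "\<dots> \<le> real (n choose 2) * (p ^ 2 * (1 - p ^ 2) ^ (2 * (n - 2)))
      + real (n choose 3) * (2 * (p ^ 3 * (1 - p ^ 3) ^ (2 * (n - 3))))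
      + real ((n choose 4) * fact 4 * 4) * (p ^ 3 * (1 - p) ^ 4 * (1 - r) ^ (n - 4))"
    unfolding card[symmetric] by (intro add_mono UN_bound finite edge_bound triangle_bound path_bound)
  \<comment> \<open>The factor 4 counts the pairs of flags and is spread over the four
    summands.\<close>
  also have "real ((n choose 4) * fact 4 * 4) * (p ^ 3 * (1 - p) ^ 4 * (1 - r) ^ (n - 4)) =
      real (n choose 4) * fact 4 * (\<Sum>m=0..3::nat. p ^ 3 * (1 - p) ^ 4 * (1 - r) ^ (n - 4))"
    by simp
  also have "\<dots> \<le> real (n choose 4) * fact 4 *
        (\<Sum>m=0..3. p ^ 3 * (1 - p) ^ (c_exponents ! m) *
           (1 - (\<Sum>l=0..8. Q_matrix ! m ! l * p ^ l * (1 - p) ^ (8 - l))) ^ (n - 4))"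
  \<comment> \<open>Summand by summand: row \<open>m\<close> is at most \<open>r \<le> 1\<close>,
    and lowering the exponent 4 to \<open>c_exponents ! m\<close> can only increase a power of
    \<open>1 - p\<close>.\<close>
  proof (intro mult_left_mono sum_mono mult_mono power_mono diff_mono order.refl)
    fix m :: nat assume "m \<in> {0..3}"
    then have m: "m \<le> 3" by simp
    show "(\<Sum>l=0..8. Q_matrix ! m ! l * p ^ l * (1 - p) ^ (8 - l)) \<le> r" "0 \<le> 1 - r"
      using Q_matrix_bound[OF assms(2,3) m] by (simp_all add: r_def)
    have "m \<in> {0, 1, 2, 3}" using m by auto
    then show "(1 - p) ^ 4 \<le> (1 - p) ^ (c_exponents ! m)"
      using assms by (intro power_decreasing) (auto simp: c_exponents_def)
  qed (use assms Q_matrix_bound(2)[OF assms(2,3), of 0] in \<open>auto simp: r_def\<close>)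
  \<comment> \<open>The truncated differences agree: \<open>2 * (n - 2) = 2 * n - 4\<close> and
    \<open>2 * (n - 3) = 2 * n - 6\<close> for every \<open>n\<close>.\<close>
  finally show ?thesis
    by (simp add: algebra_simps diff_mult_distrib2)
qed

end
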